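(* Let $a,b,m\in\mathbb{Z}$ with $a\ge 2$, $m>1$, $\gcd(b,m)=1$, and $b\ge -(a-2)m-2$. Let $n$ be the smallest positive integer such that $A_n\ge m$. The numerical semigroup $S_{a,b}(m)$ is symmetric if and only if either $n=2$, or $n\ge 3$, $u_1^{(m-1)}=a$, and $u_i^{(m-1)}=a-1$ for every $i=2,\ldots,n-2$ (the last condition being vacuous if $n=3$).
   Context: $\mathbb{N}=\{0,1,2,\dots\}$. Let $T_{a,b}(z)=az+b$, with $T_{a,b}^i$ its $i$-fold composition ($T_{a,b}^0$ the identity), and let $S_{a,b}(m)=\langle T_{a,b}^i(m)\mid i\ge 0\rangle$ be the submonoid of $(\mathbb{N},+)$ generated by the orbit of $m$; under the stated hypotheses it is a numerical semigroup (finite complement in $\mathbb{N}$) whose smallest positive element is $m$. Set $A_i=(a^i-1)/(a-1)$ for $i\ge 0$; since $m>1$, $n\ge 2$. A pseudo-Frobenius number of a numerical semigroup $S$ is an integer $x\notin S$ such that $x+s\in S$ for all $s\in S\setminus\{0\}$; $\operatorname{PF}(S)$ is the set of them, and the type is $\operatorname{t}(S)=|\operatorname{PF}(S)|$. The Frobenius number $\operatorname{F}(S)$ is the largest integer not in $S$. $S$ is symmetric if for every integer $x$ exactly one of $x$ and $\operatorname{F}(S)-x$ belongs to $S$; equivalently $\operatorname{t}(S)=1$, equivalently $\operatorname{PF}(S)=\{\operatorname{F}(S)\}$. $R(a,n)$ is the set of $\mathbf{u}=(u_1,\ldots,u_{n-1})\in\mathbb{N}^{n-1}$ such that $0\le u_j\le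 a$ for all $j$, and if $u_j=a$ then $u_k=0$ for every $k<j$. For each integer $0\le\ell<A_n$ there is a unique $\mathbf{u}^{(\ell)}=(u^{(\ell)}_1,\ldots,u^{(\ell)}_{n-1})\in R(a,n)$ with $\ell=\sum_{i=1}^{n-1}u^{(\ell)}_iA_i$, called the canonical representative of $\ell$. *)

theory Defs
  imports Main
begin

text \<open>Numerical semigroups are represented as sets of integers contained in \<open>{0..}\<close>, so that
  the integers \<open>x\<close> and \<open>F(S) - x\<close> occurring in the definition of symmetry need no coercion.\<close>

inductive_set submonoid_generated :: "'a::comm_monoid_add set \<Rightarrow> 'a set" for X where
  zero: "0 \<in> submonoid_generated X"
| incl: "x \<in> X \<Longrightarrow> x \<in> submonoid_generated X"
| add: "x \<in> submonoid_generated X \<Longrightarrow> y \<in> submonoid_generated X \<Longrightarrow> x + y \<in> submonoid_generated X"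

definition numerical_semigroup :: "int set \<Rightarrow> bool" where
  "numerical_semigroup S \<longleftrightarrow>
     S \<subseteq> {0..} \<and> 0 \<in> S \<and> (\<forall>x\<in>S. \<forall>y\<in>S. x + y \<in> S) \<and> finite ({0..} - S)"

definition frobenius_number :: "int set \<Rightarrow> int" where
  "frobenius_number S = (GREATEST x. x \<notin> S)"

definition symmetric_semigroup :: "int set \<Rightarrow> bool" where
  "symmetric_semigroup S \<longleftrightarrow> (\<forall>x. (x \<in> S) \<noteq> (frobenius_number S - x \<in> S))"

definition affine_map :: "int \<Rightarrow> int \<Rightarrow> int \<Rightarrow> int" where
  "affine_map a b z = a * z + b"

definition orbit_semigroup :: "int \<Rightarrow> int \<Rightarrow> int \<Rightarrow> int set" where
  "orbit_semigroup a b m = submonoid_generated (range (\<lambda>i. (affine_map a b ^^ i) m))"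

text \<open>For \<open>a \<ge> 2\<close> the division is exact.\<close>

definition repunit :: "int \<Rightarrow> nat \<Rightarrow> int" where
  "repunit a i = (a ^ i - 1) div (a - 1)"

text \<open>A tuple \<open>(u\<^sub>1, \<dots>, u\<^sub>n\<^sub>-\<^sub>1)\<close> of natural numbers is encoded as a function that is zero outside
  \<open>{1..n - 1}\<close>, so that equality of functions is equality of tuples.\<close>

definition reduced_tuples :: "int \<Rightarrow> nat \<Rightarrow> (nat \<Rightarrow> nat) set" where
  "reduced_tuples a n =
     {u. (\<forall>j. j \<notin> {1..n - 1} \<longrightarrow> u j = 0) \<and>
         (\<forall>j\<in>{1..n - 1}. int (u j) \<le> a \<and> (int (u j) = a \<longrightarrow> (\<forall>k\<in>{1..<j}. u k = 0)))}"

text \<open>Well defined for \<open>0 \<le> l < repunit a n\<close>.\<close>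

definition canonical_rep :: "int \<Rightarrow> nat \<Rightarrow> int \<Rightarrow> nat \<Rightarrow> nat" where
  "canonical_rep a n l =
     (THE u. u \<in> reduced_tuples a n \<and> l = (\<Sum>i = 1..n - 1. int (u i) * repunit a i))"

end

theory Submission
  imports Defs "HOL-Number_Theory.Cong"
begin

text \<open>Write \<open>c = (a - 1) m + b\<close>, so that the orbit of \<open>m\<close> consists of the numbers \<open>m + A\<^sub>i c\<close> and
  \<open>S\<close> consists of the numbers \<open>k m + l c\<close> with \<open>k\<close> at least the least number \<open>g(l)\<close> of coins among
  \<open>A\<^sub>1, A\<^sub>2, \<dots>\<close> that pay \<open>l\<close>. Greedy payment is optimal for these coins. As
  \<open>c \<ge> m - 2\<close>, the least element of \<open>S\<close> in the residue class of \<open>r c\<close> is \<open>g(r) m + r c\<close> for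
  \<open>0 \<le> r < m\<close>, and \<open>S\<close> is symmetric iff \<open>g(r) + g(m - 1 - r) = g(m - 1)\<close> for all \<open>r < m\<close>.

  Let \<open>m - 1 = q A\<^sub>k\<^sub>+\<^sub>1 + M\<close> with \<open>M < A\<^sub>k\<^sub>+\<^sub>1\<close> and \<open>k = n - 2 > 0\<close>. On \<open>[0, A\<^sub>k\<^sub>+\<^sub>1)\<close> the function \<open>g\<close> has
  its unique maximum at \<open>A\<^sub>k\<^sub>+\<^sub>1 - k\<close>, whose digits are \<open>a, a - 1, \<dots>, a - 1\<close>. Additivity at
  \<open>r = A\<^sub>k\<^sub>+\<^sub>1 - k\<close> forces \<open>M = r\<close>; conversely the formula \<open>g(A\<^sub>k\<^sub>+\<^sub>1 - s) = s (a - 1) + 1\<close> for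
  \<open>1 \<le> s \<le> k\<close> settles the remainders that exceed \<open>M\<close>.\<close>

section \<open>Greedy change with repunit coins\<close>

text \<open>The numbers \<open>(a ^ i - 1) / (a - 1)\<close> by a division-free recursion on
  \<open>nat\<close>; \<open>repunit_eq\<close> links them to \<open>repunit\<close>.\<close>

primrec coin :: "nat \<Rightarrow> nat \<Rightarrow> nat" where
  "coin a 0 = 0"
| "coin a (Suc i) = a * coin a i + 1"

locale repunit_coins =
  fixes a :: nat
  assumes a_ge_2: "a \<ge> 2"
begin

abbreviation A :: "nat \<Rightarrow> nat" where
  "A \<equiv> coin a"

lemma double_coin_less: "2 * A i < A (Suc i)"
proof -
  have "2 * A i \<le> a * A i"
    using a_ge_2 by (intro mult_right_mono) auto
  then show ?thesis unfolding coin.simps by linarith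
qed

lemma strict_mono_coin: "strict_mono A"
  unfolding strict_mono_Suc_iff using double_coin_less by (metis add_lessD1 mult_2)

lemma coin_mono: "i \<le> j \<Longrightarrow> A i \<le> A j"
  using strict_mono_coin by (simp add: strict_mono_less_eq)

lemma le_coin: "i \<le> A i"
  using strict_mono_coin by (rule strict_mono_imp_increasing)

lemma coin_pos: "0 < i \<Longrightarrow> 0 < A i"
  using le_coin[of i] by linarith

text \<open>The index of the largest coin not exceeding \<open>x\<close>; it is \<open>0\<close> for
  \<open>x = 0\<close> because \<open>A 0 = 0\<close>.\<close>

definition level :: "nat \<Rightarrow> nat" where
  "level x = (LEAST k. x < A (Suc k))"

lemma less_coin_Suc_level: "x < A (Suc (level x))"
  unfolding level_def by (rule LeastI[of _ x]) (use le_coin[of "Suc x"] in linarith)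

lemma coin_level_le: "A (level x) \<le> x"
proof (cases "level x")
  case (Suc k)
  then have "\<not> x < A (Suc k)"
    using not_less_Least[of k "\<lambda>k. x < A (Suc k)"] unfolding level_def by simp
  then show ?thesis using Suc by simp
qed simp

lemma level_eq:
  assumes "A k \<le> x" "x < A (Suc k)"
  shows "level x = k"
proof -
  have "A k < A (Suc (level x))" "A (level x) < A (Suc k)"
    using assms less_coin_Suc_level[of x] coin_level_le[of x] by linarith+
  then show ?thesis
    using strict_mono_coin by (simp add: strict_mono_less del: coin.simps)
qed

lemma level_pos: "0 < x \<Longrightarrow> 0 < level x"
  using less_coin_Suc_level[of x] by (cases "level x") auto

text \<open>The number of coins in the greedy payment of \<open>x\<close>.\<close>

function change :: "nat \<Rightarrow> nat" where
  "change x = (if x = 0 then 0 else Suc (change (x - A (level x))))"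
  by auto

termination
  by (relation "measure id") (use coin_pos level_pos in auto)

declare change.simps[simp del]

lemma change_0 [simp]: "change 0 = 0"
  by (simp add: change.simps)

lemma change_eq_0_iff [simp]: "change x = 0 \<longleftrightarrow> x = 0"
  by (subst change.simps) simp

lemma change_step:
  assumes "0 < k" "A k \<le> x" "x < A (Suc k)"
  shows "change x = Suc (change (x - A k))"
proof -
  have "x \<noteq> 0" using assms coin_pos[of k] by linarith
  then show ?thesis
    using level_eq[OF assms(2,3)] by (subst change.simps) simp
qed

lemma obtain_level:
  assumes "0 < x"
  obtains k where "0 < k" "A k \<le> x" "x < A (Suc k)"
  using assms level_pos coin_level_le less_coin_Suc_level by blast

text \<open>Below \<open>A (Suc k)\<close> the greedy choice is \<open>A k\<close> as long as that
  coin fits, so \<open>q\<close> copies can be split off; \<open>y\<close> itself may still exceed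
  \<open>A k\<close>.\<close>

lemma change_digit:
  assumes "0 < k" "q * A k + y < A (Suc k)"
  shows "change (q * A k + y) = q + change y"
  using assms(2)
proof (induction q)
  case (Suc q)
  have "change (Suc q * A k + y) = Suc (change (Suc q * A k + y - A k))"
    by (rule change_step) (use Suc.prems assms(1) in auto)
  then show ?case using Suc by simp
qed simp

lemma change_coin: "0 < k \<Longrightarrow> change (A k) = 1"
  using change_step[of k "A k"] strict_monoD[OF strict_mono_coin, of k "Suc k"] by simp

lemma change_pred_coin: "0 < k \<Longrightarrow> change (A k - 1) \<le> a"
proof -
  assume "0 < k"
  then obtain j where j: "k = Suc j" by (cases k) auto
  show ?thesis
    using change_digit[of j a 0] j by (cases "j = 0") auto
qed

text \<open>Stripping largest coins leads to the case that \<open>y\<close> is a coin, where one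
  coin is exchanged for at most \<open>a\<close>. The bound pays for the unit lost in a carry,
  \<open>A (Suc k) = a * A k + 1\<close>.\<close>

lemma change_pred: "0 < y \<Longrightarrow> change (y - 1) \<le> a - 1 + change y"
proof (induction y rule: less_induct)
  case (less y)
  obtain k where k: "0 < k" "A k \<le> y" "y < A (Suc k)"
    using obtain_level less.prems by metis
  show ?case
  proof (cases "y = A k")
    case True
    then show ?thesis using change_coin[OF k(1)] change_pred_coin[OF k(1)] a_ge_2 by simp
  next
    case False
    have "change (y - 1) = Suc (change (y - 1 - A k))"
      using k False by (intro change_step) auto
    moreover have "change (y - A k - 1) \<le> a - 1 + change (y - A k)"
      using k False coin_pos[OF k(1)] by (intro less.IH) auto
    ultimately show ?thesis using change_step[OF k] by (simp add: diff_commute)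
  qed
qed

text \<open>Core of the optimality of greedy payment. The new coin exceeds \<open>x\<close>, or it
  leaves the largest coin of \<open>x\<close> in first place, or it lifts the amount to
  \<open>A (Suc k)\<close>; only this last case, a carry, is delicate.\<close>

lemma change_add_coin: "0 < j \<Longrightarrow> change (x + A j) \<le> Suc (change x)"
proof (induction x arbitrary: j rule: less_induct)
  case (less x)
  show ?case
  proof (cases "x = 0")
    case True
    then show ?thesis using change_coin less.prems by simp
  next
    case False
    then obtain k where k: "0 < k" "A k \<le> x" "x < A (Suc k)"
      using obtain_level by (metis neq0_conv)
    have step: "change x = Suc (change (x - A k))" using change_step[OF k] .
    have Ak: "0 < A k" using coin_pos[OF k(1)] .
    consider "k < j" | "j \<le> k" "x + A j < A (Suc k)" | "j \<le> k" "A (Suc k) \<le> x + A j"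
      by linarith
    then show ?thesis
    proof cases
      case 1
      then have "x < A j" using k(3) coin_mono[of "Suc k" j] by simp
      then have "change (x + A j) = Suc (change (x + A j - A j))"
        using less.prems double_coin_less[of j] by (intro change_step) linarith+
      then show ?thesis by simp
    next
      case 2
      have "change (x + A j) = Suc (change (x + A j - A k))"
        using 2 k by (intro change_step) auto
      moreover have "change (x - A k + A j) \<le> Suc (change (x - A k))"
        using less.prems k Ak by (intro less.IH) auto
      ultimately show ?thesis using step k by simp
    next
      case 3
      have Aj: "A j \<le> A k" "0 < A j" using 3 coin_mono coin_pos less.prems by auto
      have "change (x + A j) = Suc (change (x + A j - A (Suc k)))"
        using 3 k Aj double_coin_less[of "Suc k"] double_coin_less[of k]
        by (intro change_step) linarith+
      \<comment> \<open>If \<open>x = a * A k\<close>, the rest is \<open>A j - 1\<close>. Otherwise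
        \<open>x\<close> starts with \<open>a - 1\<close> coins \<open>A k\<close>, which make up
        for the loss of at most \<open>a - 1\<close> in \<open>change_pred\<close>.\<close>
      moreover have "change (x + A j - A (Suc k)) \<le> change x"
      proof (cases "a * A k \<le> x")
        case True
        then have x: "x = a * A k" using k by simp
        have "change x = a" using change_digit[of k a 0] k x by simp
        then show ?thesis using x change_pred_coin[OF less.prems] by simp
      next
        case False
        obtain d where d: "a = Suc d" "0 < d" using a_ge_2 by (cases a) auto
        \<comment> \<open>The carry together with \<open>A j \<le> A k\<close> forces
          \<open>x > d * A k\<close>, hence \<open>r > 0\<close>.\<close>
        define r where "r = x - d * A k"
        have x: "x = d * A k + r" "0 < r" "r < A k"
          using 3 Aj False d by (auto simp: r_def)
        have cx: "change x = d + change r"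
          using change_digit[of k d r] x k by simp
        have rest: "x + A j - A (Suc k) = r + A j - A k - 1"
          using x d by simp
        have pos: "0 < r + A j - A k" using 3 x d by simp
        have "change (r + A j - A k) \<le> change r"
        proof (cases "j = k")
          case False
          have "Suc (change (r + A j - A k)) = change (r + A j)"
            using pos x Aj double_coin_less[of k] k
            by (intro change_step[symmetric]) linarith+
          also have "\<dots> \<le> Suc (change r)"
            using x d k less.prems by (intro less.IH) auto
          finally show ?thesis by simp
        qed simp
        then show ?thesis
          using change_pred[OF pos] cx rest d by simp
      qed
      ultimately show ?thesis by simp
    qed
  qed
qed

text \<open>The coins of the greedy payment of \<open>y\<close> are added one at a time. As each
  coin has change one, no payment can use fewer coins than the greedy one.\<close>

lemma change_add: "change (x + y) \<le> change x + change y"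
proof (induction y rule: less_induct)
  case (less y)
  show ?case
  proof (cases "y = 0")
    case False
    then obtain k where k: "0 < k" "A k \<le> y" "y < A (Suc k)"
      using obtain_level by (metis neq0_conv)
    have "change (x + y) = change (x + (y - A k) + A k)" using k by simp
    also have "\<dots> \<le> Suc (change (x + (y - A k)))" using change_add_coin[OF k(1)] .
    also have "change (x + (y - A k)) \<le> change x + change (y - A k)"
      using k coin_pos[OF k(1)] by (intro less.IH) auto
    finally show ?thesis using change_step[OF k] by simp
  qed simp
qed

lemma change_le: "change x \<le> x"
proof (induction x)
  case (Suc x)
  then show ?case using change_add[of x 1] change_coin[of 1] by simp
qed simp

section \<open>Where greedy change is additive\<close>

declare coin.simps(2) [simp del]

lemma coin_1 [simp]: "A (Suc 0) = 1"
  by (simp add: coin.simps)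

lemma coin_2 [simp]: "A (Suc (Suc 0)) = Suc a"
  by (simp add: coin.simps)

text \<open>Each level peels off \<open>a - 1\<close> coins and lowers \<open>s\<close> by one,
  until \<open>s = 1\<close>, where \<open>A (Suc k) - 1 = a * A k\<close>.\<close>

lemma change_coin_minus:
  assumes "0 < s" "s \<le> k"
  shows "change (A (Suc k) - s) = s * (a - 1) + 1"
  using assms
proof (induction k arbitrary: s)
  case (Suc k)
  obtain d where d: "a = Suc d" "0 < d" using a_ge_2 by (cases a) auto
  show ?case
  proof (cases "s = 1")
    case True
    then show ?thesis
      using change_digit[of "Suc k" a 0] a_ge_2 by (simp add: coin.simps(2)[of _ "Suc k"])
  next
    case False
    then obtain t where t: "s = Suc t" "0 < t" "t \<le> k" using Suc.prems by (cases s) auto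
    have "t \<le> A (Suc k)" using t le_coin[of "Suc k"] by simp
    then have eq: "A (Suc (Suc k)) - s = d * A (Suc k) + (A (Suc k) - t)"
      using t d by (simp add: coin.simps(2)[of _ "Suc k"])
    have "change (A (Suc (Suc k)) - s) = d + change (A (Suc k) - t)"
      unfolding eq using t \<open>t \<le> A (Suc k)\<close> d
      by (intro change_digit) (simp_all add: coin.simps(2)[of _ "Suc k"])
    then show ?thesis using Suc.IH[of t] t d by simp
  qed
qed simp

text \<open>A leading digit \<open>q \<le> a - 1\<close> adds to the bound of the level below, and
  equality forces \<open>q = a - 1\<close> over the lower maximiser. The digit \<open>q = a\<close>
  leaves remainder zero and costs only \<open>a\<close>, which is too little.\<close>

lemma change_maximum:
  assumes "0 < k" "x < A (Suc k)"
  shows "change x \<le> k * (a - 1) + 1 \<and> (change x = k * (a - 1) + 1 \<longrightarrow> x = A (Suc k) - k)"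
  using assms
proof (induction k arbitrary: x rule: nat_induct_non_zero)
  case 1
  then show ?case using change_digit[of 1 x 0] a_ge_2 by auto
next
  case (Suc k)
  obtain d where d: "a = Suc d" "0 < d" using a_ge_2 by (cases a) auto
  define q r where "q = x div A (Suc k)" and "r = x mod A (Suc k)"
  have pos: "0 < A (Suc k)" by (simp add: coin_pos)
  have x: "x = q * A (Suc k) + r" "r < A (Suc k)"
    using pos by (simp_all add: q_def r_def div_mult_mod_eq)
  have cx: "change x = q + change r"
    using change_digit[of "Suc k" q r] x Suc.prems by simp
  show ?case
  proof (cases "q \<le> d")
    case True
    have "x = A (Suc (Suc k)) - Suc k" if "q = d" "r = A (Suc k) - k"
      using that x d le_coin[of "Suc k"]
      by (simp add: coin.simps(2)[of _ "Suc k"])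
    then show ?thesis using Suc.IH[OF x(2)] cx d True by auto
  next
    case False
    have "x \<le> a * A (Suc k)" using Suc.prems by (simp add: coin.simps(2)[of _ "Suc k"])
    then have "q \<le> a" unfolding q_def using pos
      by (metis div_le_mono nonzero_mult_div_cancel_right less_numeral_extra(3))
    then have "q = a" using False d by simp
    then have "r = 0" using x Suc.prems by (simp add: coin.simps(2)[of _ "Suc k"])
    then have "change r = 0" by simp
    then show ?thesis using d cx \<open>q = a\<close> \<open>0 < k\<close> by (cases k) auto
  qed
qed

text \<open>Equality in \<open>change_add\<close> for every splitting of \<open>N\<close>; for
  \<open>N = m - 1\<close> this is what symmetry amounts to.\<close>

definition additive_at :: "nat \<Rightarrow> bool" where
  "additive_at N \<longleftrightarrow> (\<forall>r\<le>N. change r + change (N - r) = change N)"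

lemma additive_at_less_coin_2: "N \<le> a \<Longrightarrow> additive_at N"
proof -
  have "change x = x" if "x \<le> a" for x
    using change_digit[of 1 x 0] that by simp
  then show "N \<le> a \<Longrightarrow> additive_at N" unfolding additive_at_def by simp
qed

text \<open>Subtract \<open>r\<close> digitwise in base \<open>A (Suc k)\<close>. Without a borrow,
  additivity of the remainder suffices; with a borrow, both remainders lie within \<open>k\<close>
  of \<open>A (Suc k)\<close>, where \<open>change_coin_minus\<close> is linear and its constant
  \<open>1\<close> accounts for the borrowed coin.\<close>

lemma additive_at_coin_minus_step:
  assumes k: "0 < k" and q: "q < a" and M: "additive_at (A (Suc k) - k)"
  shows "additive_at (q * A (Suc k) + (A (Suc k) - k))"
  unfolding additive_at_def
proof (intro allI impI)
  define B M where "B = A (Suc k)" and "M = B - k"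
  fix r
  assume "r \<le> q * A (Suc k) + (A (Suc k) - k)"
  then have le: "r \<le> q * B + M" by (simp add: B_def M_def)
  have B: "k < B" using le_coin[of "Suc k"] by (simp add: B_def)
  have digit: "change (i * B + y) = i + change y" if "i \<le> q" "y < B" for i y
  proof -
    have "Suc i * B \<le> a * B" using that q by (intro mult_right_mono) auto
    then show ?thesis
      using change_digit[of "Suc k" i y] that by (simp add: B_def coin.simps(2)[of _ "Suc k"])
  qed
  have top: "change (B - s) = s * (a - 1) + 1" if "0 < s" "s \<le> k" for s
    using change_coin_minus[OF that] by (simp add: B_def)
  have N: "change (q * B + M) = q + change M"
    using digit[of q M] B k by (simp add: M_def)
  define p r' where "p = r div B" and "r' = r mod B"
  have r: "r = p * B + r'" "r' < B" using B by (auto simp: p_def r'_def)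
  have "p * B < Suc q * B" using le r B k unfolding M_def mult_Suc by linarith
  then have p: "p \<le> q" using mult_less_cancel2 less_Suc_eq_le by blast
  have "change r + change (q * B + M - r) = change (q * B + M)"
  proof (cases "r' \<le> M")
    case True
    have "p * B + (q - p) * B = q * B"
      using p by (simp flip: add_mult_distrib)
    then have eq: "q * B + M - r = (q - p) * B + (M - r')"
      using True r by linarith
    have "change (M - r') + change r' = change M"
      using M[folded B_def, folded M_def] True by (simp add: additive_at_def add.commute)
    then show ?thesis
      using digit[of p r'] digit[of "q - p" "M - r'"] r p B k N unfolding eq
      by (simp add: M_def)
  next
    case False
    then have "p \<noteq> q" using le r by auto
    then obtain e where e: "q = p + Suc e" using p less_iff_Suc_add[of p q] by auto
    \<comment> \<open>The distances of the two remainders from \<open>B\<close>: after the borrow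
      the second one is \<open>M + B - r' = B - t\<close>.\<close>
    define s t where "s = B - r'" and "t = r' - M"
    have st: "0 < s" "0 < t" "s + t = k" "r' = B - s"
      using False r B by (auto simp: s_def t_def M_def)
    have eq: "q * B + M - r = e * B + (B - t)"
      using e r st B by (simp add: M_def algebra_simps)
    have "change (q * B + M - r) = e + (t * (a - 1) + 1)"
      unfolding eq using digit[of e "B - t"] top[of t] e st B by simp
    moreover have "change r = p + (s * (a - 1) + 1)"
      using r digit[of p r'] top[of s] p st by simp
    moreover have "change M = (s + t) * (a - 1) + 1"
      using top[of k] k st(3) by (simp add: M_def)
    ultimately show ?thesis using N e unfolding add_mult_distrib by linarith
  qed
  then show "change r + change (q * A (Suc k) + (A (Suc k) - k) - r)
      = change (q * A (Suc k) + (A (Suc k) - k))"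
    by (simp only: B_def M_def)
qed

lemma coin_Suc_minus:
  "A (Suc (Suc k)) - Suc k = (a - 1) * A (Suc k) + (A (Suc k) - k)"
proof -
  obtain d where "a = Suc d" using a_ge_2 by (cases a) auto
  then show ?thesis
    using le_coin[of "Suc k"] by (simp add: coin.simps(2)[of _ "Suc k"])
qed

text \<open>By \<open>coin_Suc_minus\<close> the step with \<open>q = a - 1\<close> climbs from
  \<open>A 2 - 1 = a\<close> to every level; one more step adds an arbitrary leading digit.\<close>

lemma additive_at_coin_minus:
  assumes "0 < k" "q < a"
  shows "additive_at (q * A (Suc k) + (A (Suc k) - k))"
proof -
  have "additive_at (A (Suc k) - k)"
    using assms(1)
  proof (induction k rule: nat_induct_non_zero)
    case 1
    then show ?case by (simp add: additive_at_less_coin_2)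
  next
    case (Suc k)
    show ?case
      unfolding coin_Suc_minus using Suc a_ge_2 by (intro additive_at_coin_minus_step) auto
  qed
  then show ?thesis using assms additive_at_coin_minus_step by blast
qed

text \<open>Additivity is tested only at the unique maximiser \<open>r = A (Suc k) - k\<close>. If
  \<open>M < r\<close>, the borrow makes \<open>change M\<close> at least the maximum, contradicting
  uniqueness; if \<open>M \<ge> r\<close>, maximality leaves nothing for
  \<open>M - r\<close>.\<close>

lemma additive_at_imp_coin_minus:
  assumes k: "0 < k" and q: "0 < q" and M: "M < A (Suc k)"
    and N: "q * A (Suc k) + M < A (Suc (Suc k))" and add: "additive_at (q * A (Suc k) + M)"
  shows "M = A (Suc k) - k"
proof -
  define B where "B = A (Suc k)"
  have B: "k < B" using le_coin[of "Suc k"] by (simp add: B_def)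
  have digit: "change (i * B + y) = i + change y" if "i * B + y \<le> q * B + M" for i y
    using that N by (intro change_digit[of "Suc k", folded B_def]) (simp_all add: B_def)
  have additive: "change r + change (q * B + M - r) = q + change M" if "r \<le> q * B + M" for r
    using add that digit[of q M] by (simp add: additive_at_def B_def)
  have max: "change x \<le> change (B - k)" "change x = change (B - k) \<Longrightarrow> x = B - k"
    if "x < B" for x
    using change_maximum[OF k, of x] change_coin_minus[OF k, of k] that by (auto simp: B_def)
  obtain e where e: "q = Suc e" using q by (cases q) auto
  have "M = B - k"
  proof (cases "M < B - k")
    case True
    have eq: "q * B + M - (B - k) = e * B + (M + k)"
      using e B by simp
    have "change (B - k) + (e + change (M + k)) = q + change M"
      using additive[of "B - k"] digit[of e "M + k"] e B unfolding eq by simp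
    moreover have "change (M + k) \<noteq> 0" using k by simp
    ultimately have "change (B - k) \<le> change M" using e by linarith
    then show ?thesis using max[of M] M by (simp add: B_def)
  next
    case False
    have eq: "q * B + M - (B - k) = q * B + (M - (B - k))"
      using False by simp
    have "change (B - k) + (q + change (M - (B - k))) = q + change M"
      using additive[of "B - k"] digit[of q "M - (B - k)"] False unfolding eq by simp
    then have "change (M - (B - k)) = 0" using max(1)[of M] M unfolding B_def by linarith
    then show ?thesis using False by simp
  qed
  then show ?thesis by (simp add: B_def)
qed

section \<open>Canonical representatives\<close>


definition reduced_value :: "nat \<Rightarrow> (nat \<Rightarrow> nat) \<Rightarrow> nat" where
  "reduced_value n u = (\<Sum>i = 1..n - 1. u i * A i)"

lemma reduced_value_Suc:
  "reduced_value (Suc (Suc n)) u = reduced_value (Suc n) u + u (Suc n) * A (Suc n)"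
  by (simp add: reduced_value_def)

lemma reduced_tuples_iff:
  "u \<in> reduced_tuples (int a) n \<longleftrightarrow>
    (\<forall>j. j \<notin> {1..n - 1} \<longrightarrow> u j = 0) \<and>
    (\<forall>j\<in>{1..n - 1}. u j \<le> a \<and> (u j = a \<longrightarrow> (\<forall>k\<in>{1..<j}. u k = 0)))"
  by (simp add: reduced_tuples_def)

lemma reduced_tuples_truncate:
  assumes "u \<in> reduced_tuples (int a) (Suc (Suc n))"
  shows "u(Suc n := 0) \<in> reduced_tuples (int a) (Suc n)"
  using assms a_ge_2 unfolding reduced_tuples_iff by (auto simp: le_Suc_eq)

lemma reduced_value_truncate:
  "reduced_value (Suc n) (u(Suc n := 0)) = reduced_value (Suc n) u"
  unfolding reduced_value_def by (intro sum.cong) auto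

text \<open>A top digit \<open>a\<close> annihilates the lower digits and gives one less than the
  next coin; a smaller top digit leaves room for a lower part below
  \<open>A (Suc n)\<close>.\<close>

lemma reduced_value_less:
  assumes "u \<in> reduced_tuples (int a) (Suc n)"
  shows "reduced_value (Suc n) u < A (Suc n)"
  using assms
proof (induction n arbitrary: u)
  case 0
  then show ?case by (simp add: reduced_value_def)
next
  case (Suc n)
  have IH: "reduced_value (Suc n) u < A (Suc n)"
    using Suc.IH[OF reduced_tuples_truncate[OF Suc.prems]] by (simp only: reduced_value_truncate)
  have u: "u (Suc n) \<le> a" "u (Suc n) = a \<Longrightarrow> \<forall>k\<in>{1..n}. u k = 0"
    using Suc.prems unfolding reduced_tuples_iff by auto
  show ?case
  proof (cases "u (Suc n) = a")
    case True
    then have "reduced_value (Suc n) u = 0"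
      using u by (simp add: reduced_value_def)
    then show ?thesis using True by (simp add: reduced_value_Suc coin.simps(2)[of _ "Suc n"])
  next
    case False
    then have "Suc (u (Suc n)) * A (Suc n) \<le> a * A (Suc n)"
      using u by (intro mult_right_mono) auto
    then show ?thesis
      using IH by (simp add: reduced_value_Suc add: coin.simps(2)[of _ "Suc n"])
  qed
qed

text \<open>By \<open>reduced_value_less\<close> the top digit is the quotient by the top coin; the
  remaining digits follow inductively.\<close>

lemma reduced_value_inject:
  assumes "u \<in> reduced_tuples (int a) (Suc n)" "v \<in> reduced_tuples (int a) (Suc n)"
    and "reduced_value (Suc n) u = reduced_value (Suc n) v"
  shows "u = v"
  using assms
proof (induction n arbitrary: u v)
  case 0
  then show ?case unfolding reduced_tuples_iff by auto
next
  case (Suc n)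
  have less: "reduced_value (Suc n) w < A (Suc n)"
    if "w \<in> reduced_tuples (int a) (Suc (Suc n))" for w
    using reduced_value_less[OF reduced_tuples_truncate[OF that]]
    by (simp only: reduced_value_truncate)
  have eq: "reduced_value (Suc n) u + u (Suc n) * A (Suc n)
      = reduced_value (Suc n) v + v (Suc n) * A (Suc n)"
    using Suc.prems(3) by (simp only: reduced_value_Suc)
  have "u (Suc n) = (reduced_value (Suc n) u + u (Suc n) * A (Suc n)) div A (Suc n)"
    using less[OF Suc.prems(1)] by simp
  also have "\<dots> = v (Suc n)"
    unfolding eq using less[OF Suc.prems(2)] by simp
  finally have top: "u (Suc n) = v (Suc n)" .
  then have rest: "u(Suc n := 0) = v(Suc n := 0)"
    using eq Suc.prems(1,2)
    by (intro Suc.IH reduced_tuples_truncate) (simp_all only: reduced_value_truncate add_right_cancel)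
  have "u j = v j" for j
    using top fun_cong[OF rest, of j] by (cases "j = Suc n") auto
  then show ?case by blast
qed

lemma reduced_tuple_exists:
  assumes "l < A (Suc n)"
  shows "\<exists>u \<in> reduced_tuples (int a) (Suc n). reduced_value (Suc n) u = l"
  using assms
proof (induction n arbitrary: l)
  case 0
  then show ?case by (auto simp: reduced_tuples_iff reduced_value_def)
next
  case (Suc n)
  have pos: "0 < A (Suc n)" by (simp add: coin_pos)
  define q r where "q = l div A (Suc n)" and "r = l mod A (Suc n)"
  have l: "l = r + q * A (Suc n)" "r < A (Suc n)"
    using pos by (simp_all add: q_def r_def div_mult_mod_eq mod_div_mult_eq)
  have "l \<le> a * A (Suc n)" using Suc.prems by (simp add: coin.simps(2)[of _ "Suc n"])
  then have q: "q \<le> a"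
    unfolding q_def using pos div_le_mono[of l "a * A (Suc n)" "A (Suc n)"] by simp
  obtain u where u: "u \<in> reduced_tuples (int a) (Suc n)" "reduced_value (Suc n) u = r"
    using Suc.IH[OF l(2)] by blast
  \<comment> \<open>A leading digit \<open>a\<close> is admissible only over a zero tail. Here
    \<open>l \<le> a * A (Suc n)\<close> leaves \<open>r = 0\<close>, and uniqueness makes
    \<open>u\<close> the zero tuple.\<close>
  have "u k = 0" if "q = a" for k
  proof -
    have "r = 0" using l Suc.prems that by (simp add: coin.simps(2)[of _ "Suc n"])
    then have "u = (\<lambda>_. 0)"
      using u by (intro reduced_value_inject[of _ n]) (auto simp: reduced_tuples_iff reduced_value_def)
    then show ?thesis by simp
  qed
  then have zero: "\<forall>k. u k = 0" if "q = a" using that by blast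
  define v where "v = u(Suc n := q)"
  have outside: "u j = 0" if "j \<notin> {1..n}" for j
    using u(1) that unfolding reduced_tuples_iff by simp
  have inside: "u j \<le> a \<and> (u j = a \<longrightarrow> (\<forall>k\<in>{1..<j}. u k = 0))" if "j \<in> {1..n}" for j
    using u(1) that unfolding reduced_tuples_iff by simp
  have "v \<in> reduced_tuples (int a) (Suc (Suc n))"
    unfolding reduced_tuples_iff
  proof (intro conjI allI ballI impI)
    fix j assume "j \<notin> {1..Suc (Suc n) - 1}"
    then show "v j = 0" using outside[of j] by (auto simp: v_def)
  next
    fix j assume j: "j \<in> {1..Suc (Suc n) - 1}"
    show "v j \<le> a" using inside[of j] j q by (cases "j = Suc n") (simp_all add: v_def)
    fix k assume "v j = a" "k \<in> {1..<j}"
    then show "v k = 0"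
      using inside[of j] j zero by (cases "j = Suc n") (simp_all add: v_def)
  qed
  moreover have "reduced_value (Suc (Suc n)) v = l"
  proof -
    have "reduced_value (Suc n) v = reduced_value (Suc n) u"
      unfolding reduced_value_def v_def by (intro sum.cong) auto
    then show ?thesis using u(2) l(1) by (simp only: reduced_value_Suc) (simp add: v_def)
  qed
  ultimately show ?case by blast
qed

lemma repunit_eq: "repunit (int a) i = int (A i)"
proof -
  have "(int a) ^ i - 1 = int (A i) * (int a - 1)"
  proof (induction i)
    case (Suc i)
    have "int a ^ Suc i - 1 = int a * (int a ^ i - 1) + (int a - 1)"
      by (simp add: algebra_simps)
    then show ?case unfolding Suc by (simp add: coin.simps algebra_simps)
  qed simp
  then show ?thesis using a_ge_2 by (simp add: repunit_def)
qed

lemma canonical_rep_eqI: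
  assumes "u \<in> reduced_tuples (int a) (Suc n)" "reduced_value (Suc n) u = l"
  shows "canonical_rep (int a) (Suc n) (int l) = u"
proof -
  have val: "int l = (\<Sum>i = 1..Suc n - 1. int (v i) * repunit (int a) i)
      \<longleftrightarrow> reduced_value (Suc n) v = l" for v
    by (auto simp: repunit_eq reduced_value_def simp flip: of_nat_mult of_nat_sum)
  show ?thesis
    unfolding canonical_rep_def val
    using assms reduced_value_inject by (intro the_equality) auto
qed

lemma reduced_value_maximal:
  assumes "0 < k" "u 1 = a" "\<And>i. i \<in> {2..k} \<Longrightarrow> u i = a - 1"
  shows "reduced_value (Suc k) u = A (Suc k) - k"
  using assms
proof (induction k rule: nat_induct_non_zero)
  case 1
  then show ?case by (simp add: reduced_value_def)
next
  case (Suc k)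
  then show ?case
    unfolding reduced_value_Suc coin_Suc_minus by simp
qed

text \<open>The digits \<open>1\<close> to \<open>k\<close> must spell \<open>A (Suc k) - k\<close>,
  while the top digit may be any positive number below \<open>a\<close>.\<close>

lemma additive_at_iff_canonical_rep:
  assumes k: "0 < k" and N: "A (Suc k) \<le> N" "N < A (Suc (Suc k))"
  shows "additive_at N \<longleftrightarrow> canonical_rep (int a) (Suc (Suc k)) (int N) 1 = a \<and>
    (\<forall>i\<in>{2..k}. canonical_rep (int a) (Suc (Suc k)) (int N) i = a - 1)"
    (is "_ \<longleftrightarrow> ?digits")
proof
  assume add: "additive_at N"
  have pos: "0 < A (Suc k)" by (simp add: coin_pos)
  define q M where "q = N div A (Suc k)" and "M = N mod A (Suc k)"
  have decomp: "N = q * A (Suc k) + M" "M < A (Suc k)"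
    using pos by (simp_all add: q_def M_def div_mult_mod_eq)
  have "0 < q" using N(1) pos unfolding q_def by (simp add: div_greater_zero_iff)
  then have M: "M = A (Suc k) - k"
    using additive_at_imp_coin_minus[OF k] decomp N add by simp
  \<comment> \<open>A top digit \<open>a\<close> would leave no room for the positive remainder
    \<open>M\<close>.\<close>
  have "q < a"
  proof (rule ccontr)
    assume "\<not> q < a"
    then have "a * A (Suc k) \<le> q * A (Suc k)" by (intro mult_right_mono) auto
    moreover have "0 < M" using M le_coin[of "Suc k"] by simp
    ultimately show False using decomp N(2) coin.simps(2)[of a "Suc k"] by linarith
  qed
  define u where "u i = (if i = 1 then a else if i \<in> {2..k} then a - 1 else if i = Suc k then q else 0)" for i
  have "u \<in> reduced_tuples (int a) (Suc (Suc k))"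
    unfolding reduced_tuples_iff
  proof (intro conjI allI ballI impI)
    fix j assume "j \<notin> {1..Suc (Suc k) - 1}"
    then show "u j = 0" by (auto simp: u_def)
  next
    fix j
    show "u j \<le> a" using \<open>q < a\<close> by (simp add: u_def)
    fix i assume "u j = a" "i \<in> {1..<j}"
    then have "j = 1" using \<open>q < a\<close> by (simp add: u_def split: if_splits)
    then show "u i = 0" using \<open>i \<in> {1..<j}\<close> by simp
  qed
  moreover have "reduced_value (Suc (Suc k)) u = N"
    using reduced_value_maximal[of k u] k M decomp
    unfolding reduced_value_Suc by (simp add: u_def)
  ultimately have "canonical_rep (int a) (Suc (Suc k)) (int N) = u"
    by (rule canonical_rep_eqI)
  then show ?digits by (simp add: u_def)
next
  assume digits: ?digits
  obtain u where u: "u \<in> reduced_tuples (int a) (Suc (Suc k))" "reduced_value (Suc (Suc k)) u = N"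
    using reduced_tuple_exists N by blast
  have eq: "canonical_rep (int a) (Suc (Suc k)) (int N) = u" using u by (rule canonical_rep_eqI)
  have "u (Suc k) < a"
  proof (rule ccontr)
    assume "\<not> u (Suc k) < a"
    moreover have "Suc k \<in> {1..Suc (Suc k) - 1}" by simp
    then have "u (Suc k) \<le> a \<and> (u (Suc k) = a \<longrightarrow> (\<forall>i\<in>{1..<Suc k}. u i = 0))"
      using u(1) unfolding reduced_tuples_iff by blast
    ultimately have "u 1 = 0" using k by simp
    then show False using digits a_ge_2 unfolding eq by simp
  qed
  moreover have "N = u (Suc k) * A (Suc k) + (A (Suc k) - k)"
    using reduced_value_maximal[of k u] u digits k unfolding reduced_value_Suc eq by simp
  ultimately show "additive_at N" using additive_at_coin_minus[OF k] by simp
qed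

end

section \<open>Symmetry through the Apery set\<close>

lemma frobenius_number_greatest_gap:
  assumes "S \<subseteq> {0..}" "\<And>x. B \<le> x \<Longrightarrow> x \<in> S"
  shows "frobenius_number S \<notin> S" "\<And>x. frobenius_number S < x \<Longrightarrow> x \<in> S"
proof -
  have out: "-1 \<notin> S" using assms(1) by force
  \<comment> \<open>All negative integers are gaps, so the gaps are cut off at \<open>-1\<close> to
    obtain a finite set, nonempty even if there is no nonnegative gap.\<close>
  define X where "X = {-1..B} \<inter> - S"
  have "- 1 < B" using out assms(2)[of "-1"] by force
  then have "-1 \<in> X" "finite X" using out by (simp_all add: X_def)
  then have X: "finite X" "X \<noteq> {}" by auto
  have "frobenius_number S = Max X"
    unfolding frobenius_number_def
  proof (rule Greatest_equality)
    show "Max X \<notin> S" using Max_in[OF X] by (simp add: X_def)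
  next
    fix y assume "y \<notin> S"
    then have "y \<le> B" using assms(2)[of y] by force
    show "y \<le> Max X"
    proof (cases "y < -1")
      case True
      moreover have "-1 \<le> Max X" using Max_in[OF X] by (simp add: X_def)
      ultimately show ?thesis by simp
    next
      case False
      then show ?thesis using X \<open>y \<notin> S\<close> \<open>y \<le> B\<close> by (intro Max_ge) (auto simp: X_def)
    qed
  qed
  moreover have "x \<in> S" if "Max X < x" for x
  proof (rule ccontr)
    assume "x \<notin> S"
    then have "x \<le> B" using assms(2)[of x] by force
    moreover have "-1 \<le> Max X" using Max_in[OF X] by (simp add: X_def)
    ultimately have "x \<in> X" using that \<open>x \<notin> S\<close> by (simp add: X_def)
    then show False using Max_ge[OF X(1)] that by fastforce
  qed
  ultimately show "frobenius_number S \<notin> S" "\<And>x. frobenius_number S < x \<Longrightarrow> x \<in> S"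
    using Max_in[OF X] by (auto simp: X_def)
qed

section \<open>Membership in the orbit semigroup by residue classes modulo \<open>m\<close>\<close>

locale repunit_semigroup = repunit_coins +
  fixes b :: int and m :: nat and c :: int
  assumes m_gt_1: "m > 1" and coprime_b: "gcd b (int m) = 1"
    and b_ge: "b \<ge> - (int a - 2) * int m - 2"
  defines "c \<equiv> (int a - 1) * int m + b"
begin

abbreviation S :: "int set" where
  "S \<equiv> orbit_semigroup (int a) b (int m)"

definition apery :: "nat \<Rightarrow> int" where
  "apery r = int (change r) * int m + int r * c"

text \<open>This is the hypothesis on \<open>b\<close>, rewritten in terms of
  \<open>c\<close>.\<close>

lemma c_ge: "c \<ge> int m - 2"
  using b_ge by (simp add: c_def algebra_simps)

lemma c_nonneg: "c \<ge> 0"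
  using c_ge m_gt_1 by linarith

lemma coprime_c: "coprime c (int m)"
  using coprime_b gcd_add_mult[of "int m" "int a - 1" b]
  by (simp add: c_def coprime_iff_gcd_eq_1 gcd.commute)

lemma affine_map_funpow: "(affine_map (int a) b ^^ i) (int m) = int m + int (A i) * c"
proof (induction i)
  case (Suc i)
  have "(affine_map (int a) b ^^ Suc i) (int m) = int a * (int m + int (A i) * c) + b"
    by (simp add: Suc affine_map_def)
  then show ?case by (simp add: c_def coin.simps algebra_simps)
qed simp

lemma generator_mem: "int m + int (A i) * c \<in> S"
  unfolding orbit_semigroup_def
  by (rule submonoid_generated.incl) (auto simp: affine_map_funpow intro!: image_eqI[of _ _ i])

lemma change_coin_le: "change (A i) \<le> 1"
  using change_coin[of i] by (cases "i = 0") auto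

text \<open>Here \<open>k\<close> counts generators and \<open>l\<close> totals their coins;
  \<open>change_add\<close> keeps the condition under sums.\<close>

lemma mem_S_imp:
  assumes "x \<in> S"
  shows "\<exists>k l. change l \<le> k \<and> x = int k * int m + int l * c"
  using assms unfolding orbit_semigroup_def
proof (induction rule: submonoid_generated.induct)
  case zero
  show ?case by (intro exI[of _ 0]) simp
next
  case (incl x)
  then obtain i where "x = int m + int (A i) * c" by (auto simp: affine_map_funpow)
  then show ?case using change_coin_le[of i] by (intro exI[of _ 1] exI[of _ "A i"]) simp
next
  case (add x y)
  then obtain k l k' l' where "change l \<le> k" "x = int k * int m + int l * c"
    "change l' \<le> k'" "y = int k' * int m + int l' * c"
    by blast
  then show ?case using change_add[of l l']
    by (intro exI[of _ "k + k'"] exI[of _ "l + l'"]) (simp add: algebra_simps)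
qed

lemma add_mem: "x \<in> S \<Longrightarrow> y \<in> S \<Longrightarrow> x + y \<in> S"
  unfolding orbit_semigroup_def by (rule submonoid_generated.add)

lemma zero_mem: "0 \<in> S"
  unfolding orbit_semigroup_def by (rule submonoid_generated.zero)

text \<open>Each greedy coin of \<open>l\<close> uses one generator; the surplus in \<open>k\<close>
  is filled with the generator \<open>m\<close>, which belongs to \<open>A 0 = 0\<close>.\<close>

lemma mem_S_if: "change l \<le> k \<Longrightarrow> int k * int m + int l * c \<in> S"
proof (induction k arbitrary: l)
  case 0
  then show ?case using zero_mem by simp
next
  case (Suc k)
  show ?case
  proof (cases "l = 0")
    case True
    then have "int k * int m + int l * c \<in> S" using Suc.IH[of l] by simp
    from add_mem[OF this generator_mem[of 0]] show ?thesis
      using True by (simp add: algebra_simps)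
  next
    case False
    then obtain i where i: "0 < i" "A i \<le> l" "l < A (Suc i)" using obtain_level by (metis neq0_conv)
    then have "int k * int m + int (l - A i) * c \<in> S"
      using Suc.prems change_step[OF i] by (intro Suc.IH) simp
    from add_mem[OF this generator_mem[of i]] show ?thesis
      using i(2) by (simp add: of_nat_diff algebra_simps)
  qed
qed

text \<open>Replacing \<open>r\<close> by \<open>r + t m\<close> with \<open>t > 0\<close> adds at least \<open>c \<ge> m - 2\<close> multiples of \<open>m\<close>, while
  the change of \<open>r < m\<close> exceeds that of a positive number by at most \<open>m - 2\<close>.\<close>

lemma mem_S_iff:
  assumes "r < m" "[x = int r * c] (mod int m)"
  shows "x \<in> S \<longleftrightarrow> apery r \<le> x"
proof
  assume "x \<in> S"
  then obtain k l where kl: "change l \<le> k" "x = int k * int m + int l * c"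
    using mem_S_imp by blast
  have "[int l * c = int r * c] (mod int m)"
    using assms(2) kl(2) by (simp add: cong_def)
  then have "[int l = int r] (mod int m)"
    using coprime_c cong_mult_rcancel by blast
  then have "[l = r] (mod m)" by (simp add: cong_int_iff)
  then have "l mod m = r" using assms(1) by (simp add: cong_def)
  define t where "t = l div m"
  have l: "l = t * m + r"
    using \<open>l mod m = r\<close> div_mult_mod_eq[of l m] by (simp add: t_def)
  have "int (change r) \<le> int k + int t * c"
  proof (cases "t = 0")
    case True
    then show ?thesis using kl l by simp
  next
    case False
    then have "change l \<noteq> 0" using l m_gt_1 by simp
    then have "1 \<le> int k" using kl(1) by linarith
    moreover have "1 * c \<le> int t * c" using False c_nonneg by (intro mult_right_mono) auto
    ultimately show ?thesis using change_le[of r] assms(1) c_ge by linarith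
  qed
  then have "int (change r) * int m \<le> (int k + int t * c) * int m"
    by (intro mult_right_mono) auto
  then show "apery r \<le> x" using kl(2) l by (simp add: apery_def algebra_simps)
next
  assume le: "apery r \<le> x"
  have "[x = apery r] (mod int m)" using assms(2) by (simp add: apery_def cong_def)
  then obtain t where t: "x = apery r + int m * t"
    by (metis cong_iff_lin cong_sym)
  then have "0 \<le> t" using le m_gt_1 by (simp add: zero_le_mult_iff)
  then have "x = int (change r + nat t) * int m + int r * c"
    using t by (simp add: apery_def algebra_simps)
  then show "x \<in> S" using mem_S_if[of r "change r + nat t"] by simp
qed

text \<open>\<open>c\<close> is invertible modulo \<open>m\<close>, so \<open>r\<close> is
  \<open>x\<close> times an inverse of \<open>c\<close>, reduced modulo \<open>m\<close>.\<close>

lemma obtain_residue: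
  obtains r where "r < m" "[x = int r * c] (mod int m)"
proof -
  obtain y where y: "[c * y = 1] (mod int m)"
    using cong_solve_coprime_int[OF coprime_c] by auto
  define r where "r = nat (x * y mod int m)"
  have r: "int r = x * y mod int m" using m_gt_1 by (simp add: r_def)
  have "[int r * c = x * (c * y)] (mod int m)"
    unfolding r cong_def by (simp add: mod_mult_left_eq mult.assoc mult.commute[of c])
  also have "[x * (c * y) = x * 1] (mod int m)"
    using y by (rule cong_scalar_left)
  finally have "[x = int r * c] (mod int m)" by (simp add: cong_sym)
  moreover have "r < m"
    using r m_gt_1 pos_mod_bound[of "int m" "x * y"] by linarith
  ultimately show ?thesis using that by blast
qed

lemma apery_nonneg: "0 \<le> apery r"
  using c_nonneg by (simp add: apery_def)

lemma S_nonneg: "x \<in> S \<Longrightarrow> 0 \<le> x"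
  using obtain_residue[of x] mem_S_iff apery_nonneg by (metis order_trans)

lemma cofinite_S: "\<exists>B. \<forall>x\<ge>B. x \<in> S"
proof -
  have "apery r \<le> (\<Sum>r<m. apery r)" if "r < m" for r
    using that apery_nonneg by (intro member_le_sum) auto
  then show ?thesis using obtain_residue mem_S_iff by (metis order_trans)
qed

lemma numerical_semigroup_S: "numerical_semigroup S"
proof -
  obtain B where B: "\<forall>x\<ge>B. x \<in> S" using cofinite_S by blast
  have "{0..} - S \<subseteq> {0..B}"
  proof
    fix x assume "x \<in> {0..} - S"
    then show "x \<in> {0..B}" using B by (cases "B \<le> x") auto
  qed
  then have "finite ({0..} - S)" by (rule finite_subset) simp
  then show ?thesis
    unfolding numerical_semigroup_def
    by (intro conjI subsetI ballI) (simp_all add: S_nonneg zero_mem add_mem)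
qed

lemma frobenius_S:
  "frobenius_number S \<notin> S" "frobenius_number S < x \<Longrightarrow> x \<in> S"
proof -
  obtain B where "\<forall>x\<ge>B. x \<in> S" using cofinite_S by blast
  moreover have "S \<subseteq> {0..}" using S_nonneg by auto
  ultimately show "frobenius_number S \<notin> S" "frobenius_number S < x \<Longrightarrow> x \<in> S"
    using frobenius_number_greatest_gap by blast+
qed

lemma apery_cong: "[apery r = int r * c] (mod int m)"
  by (simp add: apery_def cong_def)

lemma apery_mem: "r < m \<Longrightarrow> apery r \<in> S"
  using mem_S_iff[OF _ apery_cong] by simp

lemma apery_minus_notin: "r < m \<Longrightarrow> apery r - int m \<notin> S"
  using mem_S_iff[of r "apery r - int m"] apery_cong[of r] m_gt_1
  by (simp add: cong_def)

text \<open>Such an \<open>x\<close> lies in \<open>[apery r, apery r + m)\<close> and is congruent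
  to \<open>apery r\<close>.\<close>

lemma eq_apery:
  assumes "x \<in> S" "x - int m \<notin> S" "r < m" "[x = int r * c] (mod int m)"
  shows "x = apery r"
proof -
  have "[x - int m = int r * c] (mod int m)" using assms(4) by (simp add: cong_def)
  then have "apery r \<le> x" "x - int m < apery r"
    using mem_S_iff assms by (auto simp: not_le[symmetric])
  moreover have "int m dvd x - apery r"
    using cong_trans[OF assms(4) cong_sym[OF apery_cong]] by (simp add: cong_iff_dvd_diff)
  ultimately show ?thesis using zdvd_imp_le[of "int m" "x - apery r"] by linarith
qed

lemma apery_add_iff:
  "r \<le> N \<Longrightarrow> apery r + apery (N - r) = apery N \<longleftrightarrow> change r + change (N - r) = change N"
proof -
  assume "r \<le> N"
  then have "apery r + apery (N - r) - apery N
      = (int (change r + change (N - r)) - int (change N)) * int m"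
    by (simp add: apery_def of_nat_diff algebra_simps)
  moreover have "(int (change r + change (N - r)) - int (change N)) * int m = 0
      \<longleftrightarrow> change r + change (N - r) = change N"
    using m_gt_1 by (simp only: mult_eq_0_iff) linarith
  ultimately show ?thesis by linarith
qed

text \<open>\<open>W = F(S) + m\<close> is the Apery element of some index \<open>f\<close>.
  Reflection pairs \<open>apery r\<close> with \<open>apery r'\<close> whenever
  \<open>r + r'\<close> is congruent to \<open>f\<close>; it remains to identify
  \<open>f\<close>.\<close>

lemma symmetric_imp_additive:
  assumes sym: "symmetric_semigroup S"
  shows "additive_at (m - 1)"
proof -
  define W where "W = frobenius_number S + int m"
  obtain f where f: "f < m" "[W = int f * c] (mod int m)" using obtain_residue by blast
  have W: "W = apery f"
    using frobenius_S f m_gt_1 by (intro eq_apery) (auto simp: W_def)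
  have split: "W = apery r + apery r'"
    if r: "r < m" "r' < m" "[int f = int r + int r'] (mod int m)" for r r'
  proof -
    have "frobenius_number S - apery r \<notin> S"
      using sym apery_mem[OF r(1)] unfolding symmetric_semigroup_def by blast
    moreover have "frobenius_number S - (apery r - int m) \<in> S"
      using sym apery_minus_notin[OF r(1)] unfolding symmetric_semigroup_def by blast
    moreover have "[W - apery r = int f * c - int r * c] (mod int m)"
      by (intro cong_diff f apery_cong)
    moreover have "[(int f - int r) * c = int r' * c] (mod int m)"
      using r(3) by (intro cong_scalar_right) (simp add: cong_iff_dvd_diff algebra_simps)
    ultimately have "W - apery r = apery r'"
      using r(2) by (intro eq_apery) (auto simp: W_def left_diff_distrib algebra_simps intro: cong_trans)
    then show ?thesis by simp
  qed
  \<comment> \<open>Otherwise the pair \<open>m - 1\<close>, \<open>f + 1\<close> has index sum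
    \<open>f + m\<close>. The extra \<open>m * c\<close> forces
    \<open>change f \<ge> 2 + c \<ge> m\<close>, against \<open>change f \<le> f\<close>.\<close>
  have "f = m - 1"
  proof (rule ccontr)
    assume "f \<noteq> m - 1"
    then have "f + 1 < m" using f by simp
    then have "apery f = apery (m - 1) + apery (f + 1)"
      using W split[of "m - 1" "f + 1"] m_gt_1 by (simp add: cong_def of_nat_diff algebra_simps)
    then have "int (change f) * int m
        = (int (change (m - 1)) + int (change (f + 1)) + c) * int m"
      using m_gt_1 by (simp add: apery_def of_nat_diff algebra_simps)
    then have "int (change f) = int (change (m - 1)) + int (change (f + 1)) + c"
      using m_gt_1 by simp
    moreover have "change (m - 1) \<noteq> 0" "change (f + 1) \<noteq> 0" using m_gt_1 by simp_all
    ultimately show False using change_le[of f] \<open>f + 1 < m\<close> c_ge by linarith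
  qed
  then have "apery r + apery (m - 1 - r) = apery (m - 1)" if "r \<le> m - 1" for r
    using split[of r "m - 1 - r"] W that m_gt_1 by (simp add: of_nat_diff)
  then show ?thesis unfolding additive_at_def using apery_add_iff by blast
qed

text \<open>If \<open>x = apery r + m * t\<close>, its reflection is
  \<open>apery (m - 1 - r) + m * (- 1 - t)\<close>, and exactly one of \<open>t\<close> and
  \<open>- 1 - t\<close> is nonnegative.\<close>

lemma additive_imp_symmetric:
  assumes add: "additive_at (m - 1)"
  shows "symmetric_semigroup S"
proof -
  define W where "W = apery (m - 1)"
  have split: "apery r + apery (m - 1 - r) = W" if "r < m" for r
    using add apery_add_iff[of r "m - 1"] that unfolding additive_at_def W_def by simp
  have reflect: "x \<in> S \<longleftrightarrow> W - int m - x \<notin> S" for x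
  proof -
    obtain r where r: "r < m" "[x = int r * c] (mod int m)" using obtain_residue by blast
    have "int (m - 1) * c - int r * c = int (m - 1 - r) * c"
      using r(1) by (simp add: of_nat_diff flip: left_diff_distrib)
    then have "[W - x = int (m - 1 - r) * c] (mod int m)"
      using cong_diff[OF apery_cong r(2), of "m - 1"] by (simp add: W_def)
    moreover have "[W - int m - x = W - x] (mod int m)" by (simp add: cong_iff_dvd_diff)
    ultimately have cong: "[W - int m - x = int (m - 1 - r) * c] (mod int m)"
      using cong_trans by blast
    have iff: "W - int m - x \<in> S \<longleftrightarrow> apery (m - 1 - r) \<le> W - int m - x"
      using cong m_gt_1 by (intro mem_S_iff) auto
    have "[x = apery r] (mod int m)"
      using r(2) apery_cong[of r] by (metis cong_sym cong_trans)
    then obtain t where t: "x = apery r + int m * t"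
      by (metis cong_iff_lin cong_sym)
    have "x \<in> S \<longleftrightarrow> 0 \<le> t"
      using mem_S_iff[OF r] t m_gt_1 by (simp add: zero_le_mult_iff)
    moreover have "W - int m - x \<in> S \<longleftrightarrow> 0 \<le> int m * (- 1 - t)"
    proof -
      have "W - int m - x - apery (m - 1 - r) = int m * (- 1 - t)"
        using split[OF r(1)] t by (simp add: algebra_simps)
      then show ?thesis using iff by linarith
    qed
    moreover have "0 \<le> int m * (- 1 - t) \<longleftrightarrow> \<not> 0 \<le> t"
      using m_gt_1 by (auto simp: zero_le_mult_iff)
    ultimately show ?thesis by blast
  qed
  \<comment> \<open>The reflection of \<open>0\<close> is a gap, and every gap reflects to an
    element of \<open>S\<close>, which is nonnegative.\<close>
  have "frobenius_number S = W - int m"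
    unfolding frobenius_number_def
  proof (rule Greatest_equality)
    show "W - int m \<notin> S" using reflect[of 0] zero_mem by simp
  next
    fix y assume "y \<notin> S"
    then have "W - int m - y \<in> S" using reflect[of y] by simp
    from S_nonneg[OF this] show "y \<le> W - int m" by simp
  qed
  then show ?thesis unfolding symmetric_semigroup_def by (metis reflect)
qed

end

theorem theorem6p1:
  fixes a b m :: int and n :: nat
  assumes "a \<ge> 2" and "m > 1" and "gcd b m = 1" and "b \<ge> - (a - 2) * m - 2"
    and "n = (LEAST k. 0 < k \<and> repunit a k \<ge> m)"
  shows "numerical_semigroup (orbit_semigroup a b m) \<and>
    (symmetric_semigroup (orbit_semigroup a b m) \<longleftrightarrow>
      n = 2 \<or>
      (n \<ge> 3 \<and> int (canonical_rep a n (m - 1) 1) = a \<and>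
       (\<forall>i\<in>{2..n - 2}. int (canonical_rep a n (m - 1) i) = a - 1)))"
proof -
  define a' m' where "a' = nat a" and "m' = nat m"
  have am: "a = int a'" "m = int m'" using assms by (simp_all add: a'_def m'_def)
  interpret repunit_semigroup a' b m' "(int a' - 1) * int m' + b"
    using assms(1-4) unfolding am by unfold_locales auto
  have least: "n = (LEAST k. 0 < k \<and> m' \<le> A k)"
    using assms(5) by (simp add: am repunit_eq)
  have "0 < n \<and> m' \<le> A n"
    unfolding least by (rule LeastI[of _ m']) (use m_gt_1 le_coin in auto)
  moreover have "A (n - 1) < m'"
  \<comment> \<open>For \<open>n = 1\<close> minimality says nothing, as index \<open>0\<close> is
    excluded from the \<open>LEAST\<close>; but \<open>A 0 = 0\<close>.\<close>
  proof (cases "n = 1")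
    case False
    then show ?thesis
      using not_less_Least[of "n - 1" "\<lambda>k. 0 < k \<and> m' \<le> A k"] \<open>0 < n \<and> m' \<le> A n\<close>
      by (simp flip: least)
  qed (use m_gt_1 in simp)
  ultimately have n: "0 < n" "m' - 1 < A n" "A (n - 1) \<le> m' - 1" "m' \<le> A n" using m_gt_1 by linarith+
  have "n \<noteq> 1" using n m_gt_1 by auto
  then obtain k where k: "n = Suc (Suc k)"
    using n(1) not0_implies_Suc[of n] not0_implies_Suc[of "n - 1"] by auto
  have "additive_at (m' - 1) \<longleftrightarrow> n = 2 \<or> (n \<ge> 3 \<and> int (canonical_rep a n (m - 1) 1) = a \<and>
       (\<forall>i\<in>{2..n - 2}. int (canonical_rep a n (m - 1) i) = a - 1))"
  proof (cases "k = 0")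
    case True
    \<comment> \<open>Here \<open>n = 2\<close>, so \<open>m - 1 \<le> a\<close> and only unit coins
      occur.\<close>
    then show ?thesis using n(4) k additive_at_less_coin_2[of "m' - 1"] by simp
  next
    case False
    have m: "m - 1 = int (m' - 1)" using m_gt_1 by (simp add: am of_nat_diff)
    have digit: "int x = int a' - 1 \<longleftrightarrow> x = a' - 1" for x
      using a_ge_2 by linarith
    have "A (Suc k) \<le> m' - 1" "m' - 1 < A (Suc (Suc k))"
      using n(2,3) k by simp_all
    from additive_at_iff_canonical_rep[OF _ this] show ?thesis
      using False unfolding m am(1) k digit by simp
  qed
  moreover have "symmetric_semigroup (orbit_semigroup a b m) \<longleftrightarrow> additive_at (m' - 1)"
    unfolding am using symmetric_imp_additive additive_imp_symmetric by (rule iffI)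
  ultimately show ?thesis
    using numerical_semigroup_S by (simp only: am simp_thms)
qed

end
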